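(* Fix $\eta>0$. For $q\in(0,1)$ sufficiently close to $1$ set $\xi=(1-q)\eta$, let $\{\check\pi_n\}_{n\ge0}$ be the monic orthogonal polynomials on the unit circle with respect to the weight $\check{\mathbb{I}}(z)=\prod_{k\ge0}(1+\xi q^{k+\frac12}z)(1+\xi q^{k+\frac12}z^{-1})$, and let $y_n$ denote the limit of $\check\pi_n(0)$ as $q\to1$ from below. Then for all $n\ge1$ the discrete Painlevé II equation holds: $$(y_{n-1}+y_{n+1})(1-y_n^2)+\frac n\eta y_n=0.$$
   Context: The monic orthogonal polynomials with respect to a continuous positive weight $w$ on the unit circle $\mathbb{T}$ are the unique monic polynomials of degree $n=0,1,2,\dots$ that are pairwise orthogonal for $\langle f,g\rangle=\oint_{\mathbb{T}}f(z)\overline{g(z)}w(z)\frac{dz}{2\pi iz}$. *)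

theory Defs
  imports "HOL-Complex_Analysis.Complex_Analysis" "HOL-Computational_Algebra.Polynomial"
begin

definition circle_inner :: "(complex \<Rightarrow> complex) \<Rightarrow> (complex \<Rightarrow> complex) \<Rightarrow> (complex \<Rightarrow> complex) \<Rightarrow> complex" where
  "circle_inner w f g =
     contour_integral (circlepath 0 1) (\<lambda>z. f z * cnj (g z) * w z / (2 * of_real pi * \<i> * z))"

definition is_monic_opuc :: "(complex \<Rightarrow> complex) \<Rightarrow> (nat \<Rightarrow> complex poly) \<Rightarrow> bool" where
  "is_monic_opuc w p \<longleftrightarrow>
     (\<forall>n. degree (p n) = n \<and> lead_coeff (p n) = 1) \<and>
     (\<forall>m n. m \<noteq> n \<longrightarrow> circle_inner w (poly (p m)) (poly (p n)) = 0)"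

text \<open>Well defined whenever \<open>w\<close> is continuous and takes positive real values on the unit circle.\<close>

definition monic_opuc :: "(complex \<Rightarrow> complex) \<Rightarrow> nat \<Rightarrow> complex poly" where
  "monic_opuc w = (THE p. is_monic_opuc w p)"

text \<open>For \<open>0 < q < 1\<close>, real \<open>\<xi>\<close> and \<open>\<bar>z\<bar> = 1\<close> the two factors are complex conjugates of each other.\<close>

definition check_weight :: "real \<Rightarrow> real \<Rightarrow> complex \<Rightarrow> complex" where
  "check_weight \<xi> q z =
     (\<Prod>k. (1 + of_real (\<xi> * q powr (real k + 1/2)) * z) *
           (1 + of_real (\<xi> * q powr (real k + 1/2)) * inverse z))"

end

theory Submission
  imports Defs
begin

text \<open>
  With \<open>\<xi> = (1 - q) \<eta>\<close> the nodes \<open>\<xi> q\<^bsup>k+1/2\<^esup>\<close> sum to \<open>\<eta> \<surd>q\<close>, while each of them is at most \<open>\<xi>\<close>, which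
  tends to 0. Hence the weights converge to \<open>exp (\<eta> (z + 1/z))\<close> uniformly on the circle, and so do
  their moments. The Szego recursion expresses the orthogonal polynomials rationally in the moments,
  with denominators that are squared norms, so \<open>y n\<close> is the value at 0 of the orthogonal polynomials
  of the limit weight. For these, integration by parts turns \<open>z P' - n P\<close>, where \<open>P\<close> has degree \<open>n\<close>,
  into a combination of the polynomial of degree \<open>n - 1\<close> and its reversal; comparing values at 0
  yields the discrete Painleve equation.
\<close>

section \<open>The Szego recursion\<close>

text \<open>
  If \<open>c\<close> are the moments of a weight symmetric under complex conjugation, then
  \<open>toep c p k\<close> is the inner product of \<open>p\<close> with \<open>z\<^sup>k\<close>, also for negative \<open>k\<close>.
\<close>

definition toep :: "(int \<Rightarrow> real) \<Rightarrow> real poly \<Rightarrow> int \<Rightarrow> real" where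
  "toep c p k = (\<Sum>i\<le>degree p. coeff p i * c (k - int i))"

lemma toep_altdef:
  assumes "degree p \<le> n"
  shows "toep c p k = (\<Sum>i\<le>n. coeff p i * c (k - int i))"
  unfolding toep_def using assms
  by (intro sum.mono_neutral_left) (auto simp: coeff_eq_0)

lemma toep_add: "toep c (p + q) k = toep c p k + toep c q k"
proof -
  define n where "n = max (degree p) (degree q)"
  have "degree (p + q) \<le> n"
    unfolding n_def by (rule degree_add_le) auto
  moreover have "degree p \<le> n" "degree q \<le> n"
    by (auto simp: n_def)
  ultimately show ?thesis
    by (simp add: toep_altdef[of _ n] sum.distrib algebra_simps)
qed

lemma toep_smult: "toep c (smult a p) k = a * toep c p k"
  using degree_smult_le[of a p]
  by (simp add: toep_altdef[of _ "degree p"] sum_distrib_left algebra_simps)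

lemma toep_shift: "toep c (pCons 0 p) k = toep c p (k - 1)"
proof -
  have "toep c (pCons 0 p) k = (\<Sum>i\<le>Suc (degree p). coeff (pCons 0 p) i * c (k - int i))"
    by (rule toep_altdef) (rule degree_pCons_le)
  also have "\<dots> = toep c p (k - 1)"
    by (simp add: sum.atMost_Suc_shift toep_def algebra_simps del: sum.atMost_Suc)
  finally show ?thesis .
qed

text \<open>
  The Szego recursion for the pair of the monic orthogonal polynomial \<open>P\<close> and its reversal
  \<open>z\<^sup>n P(1/z)\<close>. The choice of \<open>r\<close> makes the next polynomial orthogonal to 1.
\<close>

primrec szego :: "(int \<Rightarrow> real) \<Rightarrow> nat \<Rightarrow> real poly \<times> real poly" where
  "szego c 0 = (1, 1)"
| "szego c (Suc n) =
     (let p = fst (szego c n); q = snd (szego c n);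
          r = - toep c p (- 1) / toep c p (int n)
      in (pCons 0 p + smult r q, q + smult r (pCons 0 p)))"

definition szego_poly :: "(int \<Rightarrow> real) \<Rightarrow> nat \<Rightarrow> real poly" where
  "szego_poly c n = fst (szego c n)"

definition szego_dual :: "(int \<Rightarrow> real) \<Rightarrow> nat \<Rightarrow> real poly" where
  "szego_dual c n = snd (szego c n)"

text \<open>Indexed by the degree of the polynomial; the customary Verblunsky coefficient is minus
  this value, with index \<open>n - 1\<close>.\<close>

definition verblunsky :: "(int \<Rightarrow> real) \<Rightarrow> nat \<Rightarrow> real" where
  "verblunsky c n = coeff (szego_poly c n) 0"

definition szego_ratio :: "(int \<Rightarrow> real) \<Rightarrow> nat \<Rightarrow> real" where
  "szego_ratio c n = - toep c (szego_poly c n) (- 1) / toep c (szego_poly c n) (int n)"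

lemma szego_poly_0: "szego_poly c 0 = 1" and szego_dual_0: "szego_dual c 0 = 1"
  by (simp_all add: szego_poly_def szego_dual_def)

lemma szego_poly_Suc:
  "szego_poly c (Suc n) = pCons 0 (szego_poly c n) + smult (szego_ratio c n) (szego_dual c n)"
  and szego_dual_Suc:
  "szego_dual c (Suc n) = szego_dual c n + smult (szego_ratio c n) (pCons 0 (szego_poly c n))"
  by (simp_all add: szego_poly_def szego_dual_def szego_ratio_def Let_def)

text \<open>For the dual only a bound can hold: its coefficient at \<open>n\<close> is
  \<open>verblunsky c n\<close>, which may vanish.\<close>

lemma degree_szego: "degree (szego_poly c n) \<le> n" "degree (szego_dual c n) \<le> n"
proof (induction n)
  case (Suc n)
  case 1
  then show ?case
    using Suc degree_smult_le[of "szego_ratio c n" "szego_dual c n"]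
      degree_pCons_le[of 0 "szego_poly c n"]
    by (auto simp: szego_poly_Suc intro!: degree_add_le)
  case 2
  then show ?case
    using Suc degree_smult_le[of "szego_ratio c n" "pCons 0 (szego_poly c n)"]
      degree_pCons_le[of 0 "szego_poly c n"]
    by (auto simp: szego_dual_Suc intro!: degree_add_le simp del: smult_pCons)
qed (simp_all add: szego_poly_0 szego_dual_0)

lemma coeff_szego_poly_top: "coeff (szego_poly c n) n = 1"
proof (induction n)
  case (Suc n)
  have "coeff (szego_dual c n) (Suc n) = 0"
    using degree_szego(2)[of c n] by (intro coeff_eq_0) auto
  with Suc show ?case by (simp add: szego_poly_Suc)
qed (simp add: szego_poly_0)

lemma degree_szego_poly: "degree (szego_poly c n) = n"
  using degree_szego(1)[of c n] coeff_szego_poly_top[of c n]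
  by (metis le_antisym le_degree zero_neq_one)

lemma coeff_szego_dual_0: "coeff (szego_dual c n) 0 = 1"
  by (induction n) (simp_all add: szego_dual_0 szego_dual_Suc)

lemma verblunsky_0: "verblunsky c 0 = 1"
  and verblunsky_Suc: "verblunsky c (Suc n) = szego_ratio c n"
  by (simp_all add: verblunsky_def szego_poly_0 szego_poly_Suc coeff_szego_dual_0)

lemma coeff_szego_dual_top: "coeff (szego_dual c n) n = verblunsky c n"
proof (cases n)
  case (Suc m)
  have "coeff (szego_dual c m) n = 0"
    using degree_szego(2)[of c m] Suc by (intro coeff_eq_0) auto
  then show ?thesis
    by (simp add: Suc szego_dual_Suc verblunsky_Suc coeff_szego_poly_top)
qed (simp add: szego_dual_0 verblunsky_0)

lemma toep_szego_poly_Suc: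
  "toep c (szego_poly c (Suc n)) k =
     toep c (szego_poly c n) (k - 1) + verblunsky c (Suc n) * toep c (szego_dual c n) k"
  and toep_szego_dual_Suc:
  "toep c (szego_dual c (Suc n)) k =
     toep c (szego_dual c n) k + verblunsky c (Suc n) * toep c (szego_poly c n) (k - 1)"
  by (simp_all add: szego_poly_Suc szego_dual_Suc verblunsky_Suc toep_add toep_smult toep_shift
      del: smult_pCons)

text \<open>The sum in \<open>positive\<close> is the quadratic form of the Toeplitz matrix of
  \<open>c\<close> at the coefficients of \<open>p\<close>, so all these matrices are positive
  definite.\<close>

locale toeplitz =
  fixes c :: "int \<Rightarrow> real"
  assumes symmetric: "c (- k) = c k"
    and positive: "p \<noteq> 0 \<Longrightarrow> (\<Sum>j\<le>degree p. coeff p j * toep c p (int j)) > 0"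
begin

abbreviation "P \<equiv> szego_poly c"
abbreviation "Q \<equiv> szego_dual c"
abbreviation "y \<equiv> verblunsky c"

text \<open>The symmetry z -> 1/z of the moments, applied to the reversal. The induction uses the
  hypothesis twice, at \<open>k - 1\<close> and at \<open>int n - k\<close>, which exchanges the two
  lines of the recursion.\<close>

lemma toep_dual: "toep c (Q n) (int n - k) = toep c (P n) k"
proof (induction n arbitrary: k)
  case 0
  then show ?case
    by (simp add: szego_poly_0 szego_dual_0 toep_def symmetric)
next
  case (Suc n)
  have "toep c (Q (Suc n)) (int (Suc n) - k) =
      toep c (Q n) (int n - (k - 1)) + y (Suc n) * toep c (P n) (int n - k)"
    by (simp add: toep_szego_dual_Suc algebra_simps)
  also have "toep c (P n) (int n - k) = toep c (Q n) k"
    using Suc[of "int n - k"] by simp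
  finally show ?case
    by (simp only: Suc toep_szego_poly_Suc)
qed

text \<open>Orthogonality leaves only the leading term of the quadratic form. It is kept conditional
  because the induction for \<open>orthogonal\<close> needs a nonzero denominator at the previous
  degree.\<close>

lemma orthogonal_imp_positive:
  assumes "\<And>j. j < n \<Longrightarrow> toep c (P n) (int j) = 0"
  shows "toep c (P n) (int n) > 0"
proof -
  have "P n \<noteq> 0" using coeff_szego_poly_top[of c n] by auto
  then have "0 < (\<Sum>j\<le>n. coeff (P n) j * toep c (P n) (int j))"
    using positive[of "P n"] by (simp add: degree_szego_poly)
  also have "\<dots> = (\<Sum>j\<in>{n}. coeff (P n) j * toep c (P n) (int j))"
    using assms by (intro sum.mono_neutral_right) auto
  finally show ?thesis by (simp add: coeff_szego_poly_top)
qed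

text \<open>For \<open>j = 0\<close> the ratio in the recursion was chosen to give cancellation. For
  larger \<open>j\<close> both summands vanish by induction, the dual one after reflection by
  \<open>toep_dual\<close>.\<close>

lemma orthogonal: "j < n \<Longrightarrow> toep c (P n) (int j) = 0"
proof (induction n arbitrary: j)
  case (Suc n)
  have pos: "toep c (P n) (int n) > 0"
    using Suc.IH by (rule orthogonal_imp_positive)
  show ?case
  proof (cases j)
    case 0
    have "toep c (Q n) 0 = toep c (P n) (int n)"
      using toep_dual[of n "int n"] by simp
    then show ?thesis
      using 0 pos by (simp add: toep_szego_poly_Suc verblunsky_Suc szego_ratio_def)
  next
    case (Suc i)
    have "toep c (Q n) (int j) = toep c (P n) (int (n - j))"
      using toep_dual[of n "int (n - j)"] Suc.prems by simp
    also have "\<dots> = 0"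
      using Suc Suc.prems by (intro Suc.IH) auto
    finally show ?thesis
      using Suc Suc.prems Suc.IH[of i] by (simp add: toep_szego_poly_Suc)
  qed
qed simp

lemma norm_positive: "toep c (P n) (int n) > 0"
  by (rule orthogonal_imp_positive) (rule orthogonal)

lemma toep_minus_one: "toep c (P n) (- 1) = - y (Suc n) * toep c (P n) (int n)"
  using norm_positive[of n] by (simp add: verblunsky_Suc szego_ratio_def)

text \<open>Reflection turns the dual term into the inner product of \<open>P n\<close> with 1/z,
  which is \<open>- y (Suc n)\<close> times the old squared norm.\<close>

lemma norm_Suc: "toep c (P (Suc n)) (int (Suc n)) = (1 - (y (Suc n))\<^sup>2) * toep c (P n) (int n)"
proof -
  have "toep c (Q n) (int (Suc n)) = toep c (P n) (- 1)"
    using toep_dual[of n "- 1"] by (simp add: add.commute)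
  moreover have "toep c (P (Suc n)) (int (Suc n)) =
      toep c (P n) (int n) + y (Suc n) * toep c (Q n) (int (Suc n))"
    using toep_szego_poly_Suc[of c n "int (Suc n)"] by simp
  ultimately show ?thesis
    by (simp add: toep_minus_one power2_eq_square algebra_simps)
qed

text \<open>\<open>Q n\<close> is orthogonal to z, ..., \<open>z^n\<close>, hence up to scaling the
  reproducing kernel at 0 for degree at most \<open>n\<close>. The set \<open>A\<close> admits index
  ranges exceeding the degree.\<close>

lemma dual_reproducing:
  assumes "\<And>j. j > n \<Longrightarrow> d j = 0" "finite A" "{..n} \<subseteq> A"
  shows "(\<Sum>k\<le>n. coeff (Q n) k * (\<Sum>j\<in>A. d j * c (int k - int j))) = d 0 * toep c (P n) (int n)"
proof -
  have "(\<Sum>k\<le>n. coeff (Q n) k * (\<Sum>j\<in>A. d j * c (int k - int j))) =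
        (\<Sum>k\<le>n. coeff (Q n) k * (\<Sum>j\<le>n. d j * c (int k - int j)))"
    using assms by (intro sum.cong refl arg_cong2[of _ _ _ _ "(*)"] sum.mono_neutral_right) auto
  also have "\<dots> = (\<Sum>j\<le>n. d j * (\<Sum>k\<le>n. coeff (Q n) k * c (int k - int j)))"
    unfolding sum_distrib_left by (subst sum.swap) (simp add: algebra_simps)
  also have "\<dots> = (\<Sum>j\<le>n. d j * toep c (Q n) (int j))"
    using symmetric[of "int _ - int _"] by (simp add: toep_altdef[OF degree_szego(2)])
  also have "\<dots> = (\<Sum>j\<in>{0}. d j * toep c (Q n) (int j))"
  proof (intro sum.mono_neutral_right ballI)
    fix j assume j: "j \<in> {..n} - {0}"
    then have "toep c (Q n) (int j) = toep c (P n) (int (n - j))"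
      using toep_dual[of n "int (n - j)"] by simp
    also have "\<dots> = 0"
      using j by (intro orthogonal) auto
    finally show "d j * toep c (Q n) (int j) = 0" by simp
  qed auto
  also have "\<dots> = d 0 * toep c (P n) (int n)"
    using toep_dual[of n "int n"] by simp
  finally show ?thesis .
qed

text \<open>
  The moment recurrence is integration by parts against the weight \<open>exp (\<eta> (z + 1/z))\<close>. With
  \<open>D = z P' - n P\<close> for \<open>P = P (n + 1)\<close>, a polynomial of degree at most \<open>n\<close>, it gives the
  inner products of \<open>D\<close> with all monomials, and pairing \<open>D\<close> with the dual polynomial \<open>Q n\<close>
  extracts \<open>D 0 = -(n + 1) y (n + 1)\<close>.
\<close>

lemma discrete_painleve:
  assumes rec: "\<And>k. of_int k * c k = \<eta> * (c (k - 1) - c (k + 1))"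
  shows "\<eta> * (y n + y (Suc (Suc n))) * (1 - (y (Suc n))\<^sup>2) + real (Suc n) * y (Suc n) = 0"
proof -
  define m where "m = Suc n"
  define d where "d j = (real j - real m) * coeff (P m) j" for j
  define h where "h = toep c (P m) (int m)"
  \<comment> \<open>Split \<open>j - m\<close> as \<open>(k - m) - (k - j)\<close>: the first part
    dies by orthogonality, the second is rewritten by \<open>rec\<close>.\<close>
  have D: "(\<Sum>j\<le>m. d j * c (int k - int j)) =
      \<eta> * (toep c (P m) (int k + 1) - toep c (P m) (int k - 1))" if "k < m" for k
  proof -
    have *: "d j * c (int k - int j) = (real k - real m) * (coeff (P m) j * c (int k - int j)) +
        \<eta> * (coeff (P m) j * c (int k + 1 - int j) - coeff (P m) j * c (int k - 1 - int j))" for j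
    proof -
      have "(real k - real j) * c (int k - int j) =
            \<eta> * (c (int k - 1 - int j) - c (int k + 1 - int j))"
        using rec[of "int k - int j"] by (simp add: algebra_simps)
      then have "coeff (P m) j * ((real k - real j) * c (int k - int j)) =
            coeff (P m) j * (\<eta> * (c (int k - 1 - int j) - c (int k + 1 - int j)))"
        by simp
      then show ?thesis
        by (simp add: d_def algebra_simps)
    qed
    have "(\<Sum>j\<le>m. d j * c (int k - int j)) = (real k - real m) * toep c (P m) (int k) +
        \<eta> * (toep c (P m) (int k + 1) - toep c (P m) (int k - 1))"
      by (simp only: * toep_altdef[OF degree_szego(1)] sum.distrib sum_subtractf
          flip: sum_distrib_left)
    then show ?thesis
      using orthogonal[OF that] by simp
  qed
  have vanish: "d j = 0" if "j > n" for j
    using that by (cases "j = m") (auto simp: d_def m_def coeff_eq_0 degree_szego_poly)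
  \<comment> \<open>Only the top index, where \<open>k + 1 = m\<close>, and \<open>k = 0\<close>,
    where \<open>k - 1\<close> is -1, contribute. They coincide for \<open>n = 0\<close>, hence a
    sum of two conditionals.\<close>
  have "(\<Sum>k\<le>n. coeff (Q n) k * (\<Sum>j\<le>m. d j * c (int k - int j))) =
      (\<Sum>k\<le>n. (if k = n then \<eta> * y n * h else 0) + (if k = 0 then \<eta> * y (Suc m) * h else 0))"
  proof (rule sum.cong[OF refl])
    fix k assume "k \<in> {..n}"
    then have k: "k \<le> n" "k < m" by (auto simp: m_def)
    have up: "toep c (P m) (int k + 1) = (if k = n then h else 0)"
      using orthogonal[of "Suc k" m] k by (auto simp: m_def h_def add.commute)
    have down: "toep c (P m) (int k - 1) = (if k = 0 then - y (Suc m) * h else 0)"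
      using orthogonal[of "k - 1" m] toep_minus_one[of m] k
      by (auto simp: of_nat_diff h_def Suc_le_eq)
    show "coeff (Q n) k * (\<Sum>j\<le>m. d j * c (int k - int j)) =
      (if k = n then \<eta> * y n * h else 0) + (if k = 0 then \<eta> * y (Suc m) * h else 0)"
      unfolding D[OF k(2)] up down
      by (auto simp: coeff_szego_dual_top[of c n] coeff_szego_dual_0 algebra_simps)
         (metis coeff_szego_dual_0 coeff_szego_dual_top)
  qed
  also have "\<dots> = \<eta> * (y n + y (Suc m)) * h"
    by (simp add: sum.distrib algebra_simps)
  finally have "\<eta> * (y n + y (Suc m)) * h = d 0 * toep c (P n) (int n)"
    by (subst (asm) dual_reproducing[OF vanish]) (simp_all add: m_def)
  moreover have "h = (1 - (y m)\<^sup>2) * toep c (P n) (int n)"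
    unfolding h_def m_def by (rule norm_Suc)
  moreover have "d 0 = - real m * y m"
    by (simp add: d_def verblunsky_def)
  ultimately have "(\<eta> * (y n + y (Suc m)) * (1 - (y m)\<^sup>2) + real m * y m) * toep c (P n) (int n) = 0"
    by (simp add: algebra_simps)
  then show ?thesis
    using norm_positive[of n] by (simp add: m_def)
qed

end

text \<open>Every coefficient is rational in finitely many moments, and the denominators of the
  limit are squared norms, hence nonzero.\<close>

lemma tendsto_szego:
  assumes lim: "\<And>k. ((\<lambda>q. c q k) \<longlongrightarrow> c' k) F" and "toeplitz c'"
  shows "((\<lambda>q. coeff (szego_poly (c q) n) i) \<longlongrightarrow> coeff (szego_poly c' n) i) F"
    and "((\<lambda>q. coeff (szego_dual (c q) n) i) \<longlongrightarrow> coeff (szego_dual c' n) i) F"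
proof (induction n arbitrary: i)
  case (Suc n)
  have toep: "((\<lambda>q. toep (c q) (szego_poly (c q) n) k) \<longlongrightarrow> toep c' (szego_poly c' n) k) F" for k
    unfolding toep_altdef[OF degree_szego(1)] by (intro tendsto_intros lim Suc)
  have "toep c' (szego_poly c' n) (int n) \<noteq> 0"
    using toeplitz.norm_positive[OF \<open>toeplitz c'\<close>, of n] by simp
  then have ratio: "((\<lambda>q. szego_ratio (c q) n) \<longlongrightarrow> szego_ratio c' n) F"
    unfolding szego_ratio_def by (intro tendsto_intros toep)
  have shift: "((\<lambda>q. coeff (pCons 0 (szego_poly (c q) n)) i) \<longlongrightarrow> coeff (pCons 0 (szego_poly c' n)) i) F" for i
    by (cases i) (use Suc in auto)
  case 1
  show ?case
    unfolding szego_poly_Suc coeff_add coeff_smult by (intro tendsto_intros shift ratio Suc)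
  case 2
  show ?case
    unfolding szego_dual_Suc coeff_add coeff_smult by (intro tendsto_intros shift ratio Suc)
qed (simp_all add: szego_poly_0 szego_dual_0)

section \<open>Orthogonal polynomials of a symmetric weight\<close>

lemma integral_unit_interval_reflect:
  fixes f :: "real \<Rightarrow> real"
  assumes "continuous_on {0..1} f"
  shows "integral {0..1} (\<lambda>t. f (1 - t)) = integral {0..1} f"
proof -
  have "(f has_integral integral {0..1} f) (cbox 0 1)"
    using assms by (simp add: integrable_continuous_interval integrable_integral)
  from has_integral_affinity[OF this, of "-1" 1]
  have "((\<lambda>t. f (1 - t)) has_integral integral {0..1} f) ((\<lambda>x. 1 - x) ` {0..1})"
    by simp
  then show ?thesis
    by (auto simp: integral_unique)
qed

text \<open>With z = exp (2 pi i t) and a weight \<open>g (Re z)\<close> this is the whole Fourier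
  coefficient, as the sine part integrates to 0.\<close>

definition moment :: "(real \<Rightarrow> real) \<Rightarrow> int \<Rightarrow> real" where
  "moment g k = integral {0..1} (\<lambda>t. g (cos (2 * pi * t)) * cos (2 * pi * of_int k * t))"

lemma moment_minus: "moment g (- k) = moment g k"
  by (simp add: moment_def)

lemma is_monic_opucD:
  assumes "is_monic_opuc w p"
  shows "degree (p n) = n" "coeff (p n) n = 1"
    "m \<noteq> n \<Longrightarrow> circle_inner w (poly (p m)) (poly (p n)) = 0"
proof -
  show deg: "degree (p n) = n"
    using assms by (simp add: is_monic_opuc_def)
  have "lead_coeff (p n) = 1"
    using assms unfolding is_monic_opuc_def by blast
  then show "coeff (p n) n = 1"
    by (simp only: deg)
  show "m \<noteq> n \<Longrightarrow> circle_inner w (poly (p m)) (poly (p n)) = 0"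
    using assms by (simp add: is_monic_opuc_def)
qed

text \<open>A weight on the circle that is invariant under conjugation is a function of Re z, so it
  is represented by a real function on [-1,1].\<close>

locale circle_weight =
  fixes g :: "real \<Rightarrow> real" and w :: "complex \<Rightarrow> complex"
  assumes g_continuous: "continuous_on {-1..1} g"
    and g_pos: "\<And>u. u \<in> {-1..1} \<Longrightarrow> g u > 0"
    and w_eq: "\<And>z. norm z = 1 \<Longrightarrow> w z = of_real (g (Re z))"
begin

abbreviation "IP f h \<equiv> circle_inner w (poly f) (poly h)"

lemma continuous_on_g_cos: "continuous_on A (\<lambda>t. g (cos (2 * pi * t)))"
  by (rule continuous_on_compose2[OF g_continuous]) (auto intro!: continuous_intros)

text \<open>The imaginary part is odd under t -> 1 - t, so its integral vanishes.\<close>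

lemma has_integral_fourier:
  "((\<lambda>t. of_real (g (cos (2 * pi * t))) * cis (2 * pi * of_int k * t)) has_integral
     of_real (moment g k)) {0..1}"
proof -
  define s where "s t = g (cos (2 * pi * t)) * sin (2 * pi * of_int k * t)" for t
  have s_cont: "continuous_on {0..1} s"
    unfolding s_def by (intro continuous_intros continuous_on_g_cos)
  have "s (1 - t) = - s t" for t
  proof -
    have "cos (2 * pi * (1 - t)) = cos (2 * pi * t)"
      by (simp add: algebra_simps cos_diff)
    moreover have "sin (2 * pi * of_int k * (1 - t)) = - sin (2 * pi * of_int k * t)"
      using sin_int_2pin[of k] cos_int_2pin[of k] by (simp add: algebra_simps sin_diff)
    ultimately show ?thesis by (simp add: s_def)
  qed
  with integral_unit_interval_reflect[OF s_cont] have "integral {0..1} s = 0"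
    by simp
  then have "(s has_integral 0) {0..1}"
    using integrable_integral[OF integrable_continuous_interval[OF s_cont]] by simp
  from has_integral_mult_right[OF has_integral_linear[OF this bounded_linear_of_real], of \<i>]
  have s: "((\<lambda>t. \<i> * of_real (s t)) has_integral 0) {0..1}"
    by (simp add: o_def)
  have "((\<lambda>t. g (cos (2 * pi * t)) * cos (2 * pi * of_int k * t)) has_integral moment g k) {0..1}"
    unfolding moment_def
    by (intro integrable_integral integrable_continuous_interval continuous_intros continuous_on_g_cos)
  from has_integral_linear[OF this bounded_linear_of_real]
  have "((\<lambda>t. complex_of_real (g (cos (2 * pi * t)) * cos (2 * pi * of_int k * t))) has_integral
      of_real (moment g k)) {0..1}"
    by (simp add: o_def)
  moreover have "of_real (g (cos (2 * pi * t)) * cos (2 * pi * of_int k * t)) + \<i> * of_real (s t) =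
      of_real (g (cos (2 * pi * t))) * cis (2 * pi * of_int k * t)" for t
    by (simp add: s_def complex_eq_iff)
  ultimately show ?thesis
    using has_integral_add[OF _ s] by fastforce
qed

lemma IP_integral:
  "IP f h = integral {0..1}
     (\<lambda>t. poly f (cis (2 * pi * t)) * cnj (poly h (cis (2 * pi * t))) * of_real (g (cos (2 * pi * t))))"
proof -
  have e: "exp (2 * of_real pi * \<i> * of_real t) = cis (2 * pi * t)" for t
    by (simp add: cis_conv_exp mult_ac)
  show ?thesis
    unfolding circle_inner_def contour_integral_integral vector_derivative_circlepath
    unfolding circlepath e by (simp add: w_eq)
qed

lemma IP_integrable:
  "(\<lambda>t. poly f (cis (2 * pi * t)) * cnj (poly h (cis (2 * pi * t))) * of_real (g (cos (2 * pi * t))))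
     integrable_on {0..1}"
  by (intro integrable_continuous_interval continuous_intros continuous_on_g_cos)

lemma IP_add_left: "IP (f + f') h = IP f h + IP f' h"
  unfolding IP_integral integral_add[OF IP_integrable IP_integrable, symmetric]
  by (simp add: algebra_simps)

lemma IP_smult_left: "IP (smult a f) h = a * IP f h"
  unfolding IP_integral by (subst integral_mult_right[symmetric]) (simp add: mult_ac)

lemma IP_diff_right: "IP f (h - h') = IP f h - IP f h'"
  unfolding IP_integral integral_diff[OF IP_integrable IP_integrable, symmetric]
  by (simp add: algebra_simps)

text \<open>Since \<open>cnj z\<close> is 1/z on the circle, the inner product of two monomials
  depends only on the difference of their exponents.\<close>

lemma IP_moment:
  "IP f h = (\<Sum>i\<le>degree f. \<Sum>j\<le>degree h.
     coeff f i * cnj (coeff h j) * of_real (moment g (int i - int j)))"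
proof -
  have "((\<lambda>t. \<Sum>i\<le>degree f. \<Sum>j\<le>degree h. coeff f i * cnj (coeff h j) *
      (of_real (g (cos (2 * pi * t))) * cis (2 * pi * of_int (int i - int j) * t))) has_integral
    (\<Sum>i\<le>degree f. \<Sum>j\<le>degree h.
     coeff f i * cnj (coeff h j) * of_real (moment g (int i - int j)))) {0..1}"
    by (intro has_integral_sum has_integral_mult_right has_integral_fourier) auto
  moreover have "(\<Sum>i\<le>degree f. \<Sum>j\<le>degree h. coeff f i * cnj (coeff h j) *
      (of_real (g (cos (2 * pi * t))) * cis (2 * pi * of_int (int i - int j) * t))) =
      poly f (cis (2 * pi * t)) * cnj (poly h (cis (2 * pi * t))) * of_real (g (cos (2 * pi * t)))" for t
  proof -
    have "cis (2 * pi * of_int (int i - int j) * t) = cis (2 * pi * t) ^ i * cnj (cis (2 * pi * t)) ^ j" for i j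
      by (simp add: Complex.DeMoivre cis_cnj cis_mult algebra_simps)
    then show ?thesis
      unfolding poly_altdef cnj_sum sum_product sum_distrib_right
      by (intro sum.cong refl) (simp add: sum_distrib_left sum_distrib_right mult_ac)
  qed
  ultimately show ?thesis
    unfolding IP_integral by (simp add: integral_unique)
qed

text \<open>If the continuous nonnegative integrand had integral 0, then \<open>f\<close> would
  vanish on the whole circle and have infinitely many roots.\<close>

lemma IP_self_pos:
  assumes "f \<noteq> 0"
  shows "Re (IP f f) > 0"
proof -
  define F where "F t = (cmod (poly f (cis (2 * pi * t))))\<^sup>2 * g (cos (2 * pi * t))" for t
  have F_cont: "continuous_on {0..1} F"
    unfolding F_def by (intro continuous_intros continuous_on_g_cos)
  have F_nonneg: "F t \<ge> 0" for t
    using g_pos[of "cos (2 * pi * t)"] by (simp add: F_def)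
  have "((\<lambda>t. complex_of_real (F t)) has_integral of_real (integral {0..1} F)) {0..1}"
    using has_integral_linear[OF integrable_integral[OF integrable_continuous_interval[OF F_cont]]
        bounded_linear_of_real] by (simp add: o_def)
  then have F: "integral {0..1} (\<lambda>t. complex_of_real (F t)) = of_real (integral {0..1} F)"
    by (rule integral_unique)
  have F_eq: "poly f (cis (2 * pi * t)) * cnj (poly f (cis (2 * pi * t))) *
      of_real (g (cos (2 * pi * t))) = of_real (F t)" for t
    by (simp only: F_def complex_norm_square of_real_mult)
  have IP: "IP f f = of_real (integral {0..1} F)"
    unfolding IP_integral F_eq by (rule F)
  have "integral {0..1} F \<noteq> 0"
  proof
    assume "integral {0..1} F = 0"
    then have F_0: "F t = 0" if "t \<in> {0..1}" for t
      using that integral_eq_0_iff[OF F_cont] F_nonneg by simp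
    have root: "poly f (cis (2 * pi * t)) = 0" if "t \<in> {0..1}" for t
      using F_0[OF that] g_pos[of "cos (2 * pi * t)"] by (auto simp: F_def)
    \<comment> \<open>The upper half circle provides enough roots, and there injectivity follows
      from that of cos on [0, pi].\<close>
    have "inj_on (\<lambda>t. cis (2 * pi * t)) {0..1/2}"
    proof (rule inj_onI)
      fix s t :: real assume st: "s \<in> {0..1/2}" "t \<in> {0..1/2}" "cis (2 * pi * s) = cis (2 * pi * t)"
      have "Re (cis (2 * pi * s)) = Re (cis (2 * pi * t))"
        by (simp only: st(3))
      then have *: "cos (2 * pi * s) = cos (2 * pi * t)"
        by (simp only: cis.sel)
      have bounds: "0 \<le> 2 * pi * r" "2 * pi * r \<le> pi" if "r \<in> {0..1/2}" for r
        using that by simp_all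
      have "2 * pi * s = 2 * pi * t"
        by (rule cos_inj_pi[OF bounds(1)[OF st(1)] bounds(2)[OF st(1)]
              bounds(1)[OF st(2)] bounds(2)[OF st(2)] *])
      then show "s = t" by simp
    qed
    then have "infinite ((\<lambda>t. cis (2 * pi * t)) ` {0..1/2})"
      by (subst finite_image_iff) (auto simp: infinite_Icc)
    moreover have "(\<lambda>t. cis (2 * pi * t)) ` {0..1/2} \<subseteq> {z. poly f z = 0}"
      using root by auto
    ultimately show False
      using poly_roots_finite[OF assms] finite_subset by blast
  qed
  moreover have "integral {0..1} F \<ge> 0"
    using F_nonneg by (intro integral_nonneg integrable_continuous_interval F_cont) auto
  ultimately show ?thesis by (simp add: IP)
qed

text \<open>Induction on a strict degree bound \<open>m\<close>: subtracting a multiple of the monic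
  \<open>p m\<close> lowers it. Bounding through coefficients also covers
  \<open>f = 0\<close>.\<close>

lemma opuc_orthogonal_lower:
  assumes p: "is_monic_opuc w p" and "m \<le> n" "\<And>i. i \<ge> m \<Longrightarrow> coeff f i = 0"
  shows "IP f (p n) = 0"
  using assms(2,3)
proof (induction m arbitrary: f)
  case 0
  then have "f = 0" by (simp add: poly_eq_iff)
  then show ?case by (simp only: IP_moment) simp
next
  case (Suc m)
  define r where "r = f - smult (coeff f m) (p m)"
  note deg = is_monic_opucD(1,2)[OF p]
  have "coeff r i = 0" if "i \<ge> m" for i
    using that deg[of m] Suc.prems(2)[of i] by (cases "i = m") (auto simp: r_def coeff_eq_0)
  then have "IP r (p n) = 0"
    using Suc.prems(1) by (intro Suc.IH) auto
  moreover have "IP (p m) (p n) = 0"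
    using Suc.prems(1) by (intro is_monic_opucD(3)[OF p]) auto
  moreover have "smult (coeff f m) (p m) + r = f"
    by (simp add: r_def)
  ultimately show ?case
    using IP_add_left[of "smult (coeff f m) (p m)" r "p n"]
    by (simp only: IP_smult_left mult_zero_right add_0)
qed

text \<open>The difference of two monic candidates has degree below \<open>n\<close>, so it is
  orthogonal to both of them and hence to itself.\<close>

lemma monic_opuc_unique:
  assumes p: "is_monic_opuc w p" and q: "is_monic_opuc w q"
  shows "p = q"
proof
  fix n
  have "coeff (p n - q n) i = 0" if "i \<ge> n" for i
    using that is_monic_opucD(1,2)[OF p, of n] is_monic_opucD(1,2)[OF q, of n]
    by (cases "i = n") (auto simp: coeff_eq_0)
  then have "IP (p n - q n) (p n - q n) = 0"
    using opuc_orthogonal_lower[OF p, of n n "p n - q n"]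
      opuc_orthogonal_lower[OF q, of n n "p n - q n"]
    by (subst IP_diff_right) auto
  then show "p n = q n"
    using IP_self_pos[of "p n - q n"] by auto
qed

text \<open>The quadratic form of the moments is the squared norm of \<open>p\<close> on the
  circle.\<close>

sublocale toeplitz "moment g"
proof
  fix p :: "real poly" assume "p \<noteq> 0"
  define f where "f = map_poly complex_of_real p"
  have "f \<noteq> 0"
    using \<open>p \<noteq> 0\<close> by (simp add: f_def map_poly_eq_0_iff)
  have "IP f f = of_real (\<Sum>j\<le>degree p. coeff p j * toep (moment g) p (int j))"
    by (simp add: IP_moment f_def degree_map_poly coeff_map_poly toep_def sum_distrib_left mult_ac)
  then show "(\<Sum>j\<le>degree p. coeff p j * toep (moment g) p (int j)) > 0"
    using IP_self_pos[OF \<open>f \<noteq> 0\<close>] by simp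
qed (rule moment_minus)

lemma IP_szego_lower:
  assumes "m < n"
  shows "(\<Sum>i\<le>m. \<Sum>j\<le>n. coeff (P m) i * coeff (P n) j * moment g (int i - int j)) = 0"
proof -
  have "(\<Sum>i\<le>m. \<Sum>j\<le>n. coeff (P m) i * coeff (P n) j * moment g (int i - int j)) =
      (\<Sum>i\<le>m. coeff (P m) i * toep (moment g) (P n) (int i))"
    by (simp add: toep_def degree_szego_poly sum_distrib_left mult_ac)
  also have "\<dots> = 0"
    using assms by (intro sum.neutral) (auto simp: orthogonal)
  finally show ?thesis .
qed

lemma is_monic_opuc_szego: "is_monic_opuc w (\<lambda>n. map_poly complex_of_real (P n))"
  unfolding is_monic_opuc_def
proof (intro conjI allI impI)
  fix m n :: nat assume "m \<noteq> n"
  have "IP (map_poly complex_of_real (P m)) (map_poly complex_of_real (P n)) =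
      of_real (\<Sum>i\<le>m. \<Sum>j\<le>n. coeff (P m) i * coeff (P n) j * moment g (int i - int j))"
    by (simp add: IP_moment degree_map_poly coeff_map_poly degree_szego_poly)
  also have "(\<Sum>i\<le>m. \<Sum>j\<le>n. coeff (P m) i * coeff (P n) j * moment g (int i - int j)) = 0"
  proof (cases "m < n")
    case True
    then show ?thesis by (rule IP_szego_lower)
  next
    case False
    \<comment> \<open>The case \<open>n < m\<close> reduces to the other one because the moments are
      even in the index.\<close>
    then have "(\<Sum>j\<le>n. \<Sum>i\<le>m. coeff (P n) j * coeff (P m) i * moment g (int j - int i)) = 0"
      using \<open>m \<noteq> n\<close> by (intro IP_szego_lower) auto
    moreover have "moment g (int j - int i) = moment g (int i - int j)" for i j
      using moment_minus[of g "int i - int j"] by simp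
    ultimately show ?thesis
      by (subst sum.swap) (simp add: mult_ac)
  qed
  finally show "IP (map_poly complex_of_real (P m)) (map_poly complex_of_real (P n)) = 0"
    by simp
qed (simp_all add: degree_map_poly coeff_map_poly degree_szego_poly coeff_szego_poly_top)

text \<open>Existence and uniqueness identify the definite description in \<open>monic_opuc\<close>
  with the Szego polynomials.\<close>

lemma poly_monic_opuc_0: "poly (monic_opuc w n) 0 = of_real (verblunsky (moment g) n)"
proof -
  have "monic_opuc w = (\<lambda>n. map_poly complex_of_real (P n))"
    unfolding monic_opuc_def
    by (rule the_equality, rule is_monic_opuc_szego, erule monic_opuc_unique, rule is_monic_opuc_szego)
  then show ?thesis
    by (simp add: poly_0_coeff_0 coeff_map_poly verblunsky_def)
qed

end

section \<open>Convergence of the weights\<close>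

lemma exp_diff_le:
  fixes a b M :: real
  assumes "a \<le> M" "b \<le> M"
  shows "\<bar>exp a - exp b\<bar> \<le> exp M * \<bar>a - b\<bar>"
proof -
  have *: "\<bar>exp a - exp b\<bar> \<le> exp M * \<bar>a - b\<bar>" if "a \<le> b" "b \<le> M" for a b :: real
  proof -
    have "exp b - exp a = exp b * (1 - exp (a - b))"
      by (simp add: algebra_simps flip: exp_add)
    also have "\<dots> \<le> exp M * (b - a)"
    proof (intro mult_mono)
      show "1 - exp (a - b) \<le> b - a"
        using exp_ge_add_one_self[of "a - b"] by linarith
    qed (use that in auto)
    finally show ?thesis
      using that by simp
  qed
  show ?thesis
    using *[of a b] *[of b a] assms by (cases "a \<le> b") (auto simp: abs_minus_commute)
qed

section \<open>Infinite products of quadratic factors with summable nodes\<close>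

context
  fixes x :: "nat \<Rightarrow> real"
  assumes x_pos: "\<And>k. 0 < x k" and x_less: "\<And>k. x k < 1" and x_summable: "summable x"
begin

text \<open>The factor is |1 + x z|^2 for z on the circle with real part \<open>u\<close>; it equals
  \<open>(1 - x k)^2 + 2 * x k * (1 + u)\<close>.\<close>

lemma quadratic_factor_pos:
  assumes "u \<in> {-1..1}"
  shows "1 + 2 * x k * u + (x k)\<^sup>2 > 0"
proof -
  have "(1 - x k)\<^sup>2 > 0" using x_less[of k] by simp
  moreover have "x k * (1 + u) \<ge> 0" using x_pos[of k] assms by (intro mult_nonneg_nonneg) auto
  ultimately show ?thesis by (simp add: power2_eq_square algebra_simps)
qed

lemma quadratic_factor_minus_1:
  assumes "u \<in> {-1..1}"
  shows "\<bar>2 * x k * u + (x k)\<^sup>2\<bar> \<le> 3 * x k"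
proof -
  have "\<bar>x k * u\<bar> \<le> x k * 1"
    unfolding abs_mult using x_pos[of k] assms by (intro mult_mono) auto
  moreover have "(x k)\<^sup>2 \<le> x k * 1"
    unfolding power2_eq_square using x_pos[of k] x_less[of k] by (intro mult_mono) auto
  ultimately show ?thesis using x_pos[of k] zero_le_power2[of "x k"] by linarith
qed

lemma convergent_prod_quadratic:
  assumes "u \<in> {-1..1}"
  shows "convergent_prod (\<lambda>k. 1 + 2 * x k * u + (x k)\<^sup>2)"
proof -
  have "summable (\<lambda>k. \<bar>2 * x k * u + (x k)\<^sup>2\<bar>)"
    by (rule summable_comparison_test'[OF summable_mult[OF x_summable, of 3]])
       (use quadratic_factor_minus_1[OF assms] in auto)
  from summable_imp_convergent_prod_real[OF this] show ?thesis
    using quadratic_factor_pos[OF assms] by (simp add: add.assoc) (smt (verit))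
qed

lemma prodinf_quadratic_LIMSEQ:
  assumes "u \<in> {-1..1}"
  shows "(\<lambda>N. \<Prod>k<N. 1 + 2 * x k * u + (x k)\<^sup>2) \<longlonglongrightarrow> (\<Prod>k. 1 + 2 * x k * u + (x k)\<^sup>2)"
  using has_prod_imp_tendsto'[OF convergent_prod_has_prod[OF convergent_prod_quadratic[OF assms]]] .

lemma prodinf_quadratic_pos:
  assumes "u \<in> {-1..1}"
  shows "(\<Prod>k. 1 + 2 * x k * u + (x k)\<^sup>2) > 0"
  using convergent_prod_quadratic[OF assms] quadratic_factor_pos[OF assms]
  by (rule less_0_prodinf)

text \<open>The majorant \<open>3 * x k\<close> gives uniform convergence of the partial products,
  whose uniform limit agrees with the pointwise one.\<close>

lemma continuous_on_prodinf_quadratic: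
  "continuous_on {-1..1} (\<lambda>u. \<Prod>k. 1 + 2 * x k * u + (x k)\<^sup>2)"
proof -
  have "uniformly_convergent_on {-1..1} (\<lambda>N u. \<Sum>k<N. norm (1 + 2 * x k * u + (x k)\<^sup>2 - 1))"
    by (rule Weierstrass_m_test'[OF _ summable_mult[OF x_summable, of 3]])
       (use quadratic_factor_minus_1 in auto)
  then have "uniformly_convergent_on {-1..1} (\<lambda>N u. \<Prod>k<N. 1 + 2 * x k * u + (x k)\<^sup>2)"
    by (intro uniformly_convergent_on_prod') (auto intro!: continuous_intros)
  then obtain l where l: "uniform_limit {-1..1} (\<lambda>N u. \<Prod>k<N. 1 + 2 * x k * u + (x k)\<^sup>2) l sequentially"
    by (auto simp: uniformly_convergent_on_def)
  have "continuous_on {-1..1} l"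
    by (rule uniform_limit_theorem[OF _ l]) (auto intro!: always_eventually continuous_intros)
  moreover have "l u = (\<Prod>k. 1 + 2 * x k * u + (x k)\<^sup>2)" if "u \<in> {-1..1}" for u
    using LIMSEQ_unique[OF tendsto_uniform_limitI[OF l that] prodinf_quadratic_LIMSEQ[OF that]] .
  ultimately show ?thesis
    by (rule continuous_on_eq)
qed

text \<open>The constant 5 is 4 from the Taylor remainder of exp at v with |v| at most
  \<open>2 * x k\<close>, plus 1 from the term \<open>(x k)^2\<close>. The division absorbs the
  exponential in the remainder.\<close>

lemma quadratic_factor_exp:
  assumes "u \<in> {-1..1}"
  shows "\<bar>(1 + 2 * x k * u + (x k)\<^sup>2) / exp (2 * x k) - exp (2 * x k * u) / exp (2 * x k)\<bar> \<le> 5 * (x k)\<^sup>2"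
proof -
  define v where "v = 2 * x k * u"
  have v: "\<bar>v\<bar> \<le> 2 * x k * 1"
    unfolding v_def abs_mult using x_pos[of k] assms by (intro mult_mono) auto
  have "\<bar>exp v - (1 + v)\<bar> \<le> exp \<bar>v\<bar> * v\<^sup>2"
    using Taylor_exp_field[of v 1] by (simp add: power2_eq_square)
  also have "\<dots> \<le> exp (2 * x k) * (2 * x k)\<^sup>2"
    using v power_mono[OF v, of 2] by (intro mult_mono) auto
  finally have "\<bar>exp v - (1 + v)\<bar> \<le> exp (2 * x k) * (4 * (x k)\<^sup>2)"
    by (simp add: power_mult_distrib)
  moreover have "(x k)\<^sup>2 \<le> exp (2 * x k) * (x k)\<^sup>2"
    using x_pos[of k] mult_right_mono[of 1 "exp (2 * x k)" "(x k)\<^sup>2"] by simp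
  ultimately have "\<bar>(1 + v + (x k)\<^sup>2) - exp v\<bar> \<le> exp (2 * x k) * (5 * (x k)\<^sup>2)"
    using zero_le_power2[of "x k"] by linarith
  moreover have "\<bar>a / exp c - b / exp c\<bar> = \<bar>a - b\<bar> / exp c" for a b c :: real
    by (simp add: flip: diff_divide_distrib)
  ultimately show ?thesis
    by (simp add: v_def divide_le_eq mult_ac)
qed

text \<open>
  Dividing all factors by \<open>exp (2 x k)\<close> makes them at most 1 in absolute value, so that the
  distance of the products is at most the sum of the distances of the factors.
\<close>

lemma prodinf_quadratic_exp:
  assumes u: "u \<in> {-1..1}" and b: "\<And>k. x k \<le> b"
  shows "\<bar>(\<Prod>k. 1 + 2 * x k * u + (x k)\<^sup>2) - exp (2 * suminf x * u)\<bar> \<le> exp (2 * suminf x) * (5 * b * suminf x)"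
proof -
  have partial: "\<bar>(\<Prod>k<N. 1 + 2 * x k * u + (x k)\<^sup>2) - exp (2 * (\<Sum>k<N. x k) * u)\<bar>
      \<le> exp (2 * suminf x) * (5 * b * suminf x)" for N
  proof -
    define S where "S = (\<Sum>k<N. x k)"
    have S: "S \<le> suminf x"
      unfolding S_def using x_pos by (intro sum_le_suminf x_summable) (auto intro: less_imp_le)
    have S_nonneg: "0 \<le> S"
      unfolding S_def using x_pos by (intro sum_nonneg) (auto intro: less_imp_le)
    have b_pos: "b > 0" using x_pos[of 0] b[of 0] by linarith
    have "norm ((\<Prod>k<N. (1 + 2 * x k * u + (x k)\<^sup>2) / exp (2 * x k)) - (\<Prod>k<N. exp (2 * x k * u) / exp (2 * x k)))
        \<le> (\<Sum>k<N. norm ((1 + 2 * x k * u + (x k)\<^sup>2) / exp (2 * x k) - exp (2 * x k * u) / exp (2 * x k)))"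
    proof (rule norm_prod_diff)
      fix k
      have xu: "x k * u \<le> x k" using u x_pos[of k] by simp
      \<comment> \<open>The normalised factor is at most 1 because \<open>1 + x k\<close> is at most
        \<open>exp (x k)\<close>.\<close>
      have "1 + 2 * x k * u + (x k)\<^sup>2 \<le> (1 + x k)\<^sup>2"
        using xu by (simp add: power2_eq_square algebra_simps)
      also have "\<dots> \<le> (exp (x k))\<^sup>2"
        using x_pos[of k] by (intro power_mono exp_ge_add_one_self) auto
      also have "\<dots> = exp (2 * x k)"
        by (simp add: exp_double)
      finally show "norm ((1 + 2 * x k * u + (x k)\<^sup>2) / exp (2 * x k)) \<le> 1"
        using quadratic_factor_pos[OF u, of k] by simp
      show "norm (exp (2 * x k * u) / exp (2 * x k)) \<le> 1"
        using xu by simp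
    qed
    \<comment> \<open>One of the two factors \<open>x k\<close> is bounded by \<open>b\<close>, the
      small quantity in the application; the other is summed.\<close>
    also have "\<dots> \<le> (\<Sum>k<N. 5 * b * x k)"
    proof (rule sum_mono)
      fix k
      have "(x k)\<^sup>2 \<le> b * x k"
        unfolding power2_eq_square using b[of k] x_pos[of k] by (intro mult_right_mono) auto
      then show "norm ((1 + 2 * x k * u + (x k)\<^sup>2) / exp (2 * x k) - exp (2 * x k * u) / exp (2 * x k)) \<le> 5 * b * x k"
        using quadratic_factor_exp[OF u, of k] by simp
    qed
    also have "\<dots> = 5 * b * S"
      by (simp add: S_def sum_distrib_left)
    also have "(\<Prod>k<N. exp (2 * x k * u) / exp (2 * x k)) = exp (2 * S * u) / exp (2 * S)"
      by (simp add: prod_dividef S_def sum_distrib_left sum_distrib_right flip: exp_sum)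
    also have "(\<Prod>k<N. (1 + 2 * x k * u + (x k)\<^sup>2) / exp (2 * x k)) =
        (\<Prod>k<N. 1 + 2 * x k * u + (x k)\<^sup>2) / exp (2 * S)"
      by (simp add: prod_dividef S_def sum_distrib_left flip: exp_sum)
    finally have "\<bar>(\<Prod>k<N. 1 + 2 * x k * u + (x k)\<^sup>2) - exp (2 * S * u)\<bar> \<le> exp (2 * S) * (5 * b * S)"
      by (simp add: divide_le_eq mult_ac flip: diff_divide_distrib)
    also have "\<dots> \<le> exp (2 * suminf x) * (5 * b * suminf x)"
      using S S_nonneg b_pos by (intro mult_mono) auto
    finally show ?thesis by (simp add: S_def)
  qed
  have "(\<lambda>N. \<Sum>k<N. x k) \<longlonglongrightarrow> suminf x"
    by (rule summable_LIMSEQ[OF x_summable])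
  then have "(\<lambda>N. \<bar>(\<Prod>k<N. 1 + 2 * x k * u + (x k)\<^sup>2) - exp (2 * (\<Sum>k<N. x k) * u)\<bar>) \<longlonglongrightarrow>
      \<bar>(\<Prod>k. 1 + 2 * x k * u + (x k)\<^sup>2) - exp (2 * suminf x * u)\<bar>"
    by (intro tendsto_intros prodinf_quadratic_LIMSEQ[OF u])
  then show ?thesis
    by (rule Lim_bounded) (use partial in auto)
qed

end

section \<open>The given weight as a density in u = Re z, and its distance to the limit\<close>

definition check_density :: "real \<Rightarrow> real \<Rightarrow> real \<Rightarrow> real" where
  "check_density \<xi> q u =
     (\<Prod>k. 1 + 2 * (\<xi> * q powr (real k + 1/2)) * u + (\<xi> * q powr (real k + 1/2))\<^sup>2)"

context
  fixes \<eta> q :: real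
  assumes \<eta>: "\<eta> > 0" and q: "0 < q" "q < 1" and small: "(1 - q) * \<eta> < 1"
begin

abbreviation "node k \<equiv> (1 - q) * \<eta> * q powr (real k + 1/2)"

lemma node_eq: "node k = (1 - q) * \<eta> * sqrt q * q ^ k"
  using q by (simp add: powr_add powr_realpow powr_half_sqrt)

lemma node_pos: "node k > 0"
  using \<eta> q by simp

lemma node_le: "node k \<le> (1 - q) * \<eta>"
proof -
  have "q powr (real k + 1/2) \<le> 1"
    using q by (intro powr_le1) auto
  then show ?thesis
    using \<eta> q mult_left_mono[of _ 1 "(1 - q) * \<eta>"] by simp
qed

lemma node_less_1: "node k < 1"
  using node_le[of k] small by linarith

text \<open>The factor \<open>1 - q\<close> cancels the denominator of the geometric series, so the
  total stays bounded while each node tends to 0.\<close>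

lemma node_sums: "node sums (\<eta> * sqrt q)"
  unfolding node_eq using sums_mult[OF geometric_sums[of q], of "(1 - q) * \<eta> * sqrt q"] q
  by simp

text \<open>On the circle \<open>inverse z\<close> is \<open>cnj z\<close>, so the two conjugate
  factors multiply to a real quadratic in the node.\<close>

lemma check_weight_eq:
  assumes "norm z = 1"
  shows "check_weight ((1 - q) * \<eta>) q z = of_real (check_density ((1 - q) * \<eta>) q (Re z))"
proof -
  have "\<bar>Re z\<bar> \<le> 1"
    using assms abs_Re_le_cmod[of z] by simp
  then have "Re z \<in> {-1..1}" by auto
  from convergent_prod_quadratic[of node, OF node_pos node_less_1 sums_summable[OF node_sums] this]
  have "(\<lambda>k. 1 + 2 * node k * Re z + (node k)\<^sup>2) has_prod check_density ((1 - q) * \<eta>) q (Re z)"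
    unfolding check_density_def by (rule convergent_prod_has_prod)
  then have "(\<lambda>k. complex_of_real (1 + 2 * node k * Re z + (node k)\<^sup>2)) has_prod
      of_real (check_density ((1 - q) * \<eta>) q (Re z))"
    by (simp only: has_prod_of_real_iff)
  moreover have "complex_of_real (1 + 2 * node k * Re z + (node k)\<^sup>2) =
      (1 + of_real (node k) * z) * (1 + of_real (node k) * inverse z)" for k
  proof -
    have "z * cnj z = 1"
      using assms complex_norm_square[of z] by simp
    then have "inverse z = cnj z"
      by (simp add: inverse_unique)
    moreover have "(1 + of_real r * z) * (1 + of_real r * cnj z) =
        1 + of_real r * (z + cnj z) + (of_real r)\<^sup>2 * (z * cnj z)" for r
      by (simp add: power2_eq_square algebra_simps)
    ultimately show ?thesis
      using \<open>z * cnj z = 1\<close> by (simp only: complex_add_cnj) simp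
  qed
  ultimately show ?thesis
    unfolding check_weight_def by (simp only: has_prod_unique[symmetric])
qed

lemma circle_weight_check: "circle_weight (check_density ((1 - q) * \<eta>) q) (check_weight ((1 - q) * \<eta>) q)"
proof
  show "continuous_on {-1..1} (check_density ((1 - q) * \<eta>) q)"
    unfolding check_density_def
    by (rule continuous_on_prodinf_quadratic[of node, OF node_pos node_less_1 sums_summable[OF node_sums]])
  show "check_density ((1 - q) * \<eta>) q u > 0" if "u \<in> {-1..1}" for u
    unfolding check_density_def
    by (rule prodinf_quadratic_pos[of node, OF node_pos node_less_1 sums_summable[OF node_sums] that])
qed (rule check_weight_eq)

text \<open>The first error term compares the product with the exponential of its own node sum
  \<open>\<eta> * sqrt q\<close>; the second replaces that sum by \<open>\<eta>\<close>. Both are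
  uniform in \<open>u\<close> and vanish as \<open>q\<close> tends to 1.\<close>

lemma check_density_exp:
  assumes u: "u \<in> {-1..1}"
  shows "\<bar>check_density ((1 - q) * \<eta>) q u - exp (2 * \<eta> * u)\<bar> \<le>
    exp (2 * \<eta>) * (5 * ((1 - q) * \<eta>) * \<eta>) + exp (2 * \<eta>) * (2 * \<eta> * (1 - sqrt q))"
proof -
  define s where "s = \<eta> * sqrt q"
  have s: "0 \<le> s" "s \<le> \<eta>" "suminf node = s"
    using \<eta> q node_sums by (auto simp: s_def sums_iff)
  have "\<bar>check_density ((1 - q) * \<eta>) q u - exp (2 * s * u)\<bar> \<le> exp (2 * s) * (5 * ((1 - q) * \<eta>) * s)"
    unfolding check_density_def
    using prodinf_quadratic_exp[of node, OF node_pos node_less_1 sums_summable[OF node_sums] u node_le] s by simp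
  also have "\<dots> \<le> exp (2 * \<eta>) * (5 * ((1 - q) * \<eta>) * \<eta>)"
    using s \<eta> q by (intro mult_mono) auto
  finally have 1: "\<bar>check_density ((1 - q) * \<eta>) q u - exp (2 * s * u)\<bar> \<le> exp (2 * \<eta>) * (5 * ((1 - q) * \<eta>) * \<eta>)" .
  have "2 * r * u \<le> 2 * \<eta>" if "0 \<le> r" "r \<le> \<eta>" for r
    using mult_left_mono[of u 1 r] u that by simp
  then have "\<bar>exp (2 * s * u) - exp (2 * \<eta> * u)\<bar> \<le> exp (2 * \<eta>) * \<bar>2 * s * u - 2 * \<eta> * u\<bar>"
    using s \<eta> by (intro exp_diff_le) auto
  also have "\<bar>2 * s * u - 2 * \<eta> * u\<bar> = 2 * (\<eta> - s) * \<bar>u\<bar>"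
  proof -
    have "2 * s * u - 2 * \<eta> * u = - (2 * (\<eta> - s) * u)" by (simp add: algebra_simps)
    then show ?thesis using s by (simp add: abs_mult)
  qed
  also have "exp (2 * \<eta>) * (2 * (\<eta> - s) * \<bar>u\<bar>) \<le> exp (2 * \<eta>) * (2 * (\<eta> - s) * 1)"
    using u s by (intro mult_left_mono) auto
  finally show ?thesis
    using 1 by (simp add: s_def algebra_simps)
qed

end

section \<open>The limit weight and the convergence of moments\<close>

lemma circle_weight_exp:
  "circle_weight (\<lambda>u. exp (2 * \<eta> * u)) (\<lambda>z. of_real (exp (2 * \<eta> * Re z)))"
  by unfold_locales (auto intro!: continuous_intros)

lemma moment_diff_le:
  assumes g: "continuous_on {-1..1} g" and h: "continuous_on {-1..1} h"
    and le: "\<And>u. u \<in> {-1..1} \<Longrightarrow> \<bar>g u - h u\<bar> \<le> e"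
  shows "\<bar>moment g k - moment h k\<bar> \<le> e"
proof -
  have cont: "continuous_on {0..1} (\<lambda>t. f (cos (2 * pi * t)) * cos (2 * pi * of_int k * t))"
    if "continuous_on {-1..1} f" for f :: "real \<Rightarrow> real"
    by (intro continuous_intros continuous_on_compose2[OF that]) auto
  have "moment g k - moment h k = integral {0..1} (\<lambda>t. (g (cos (2 * pi * t)) * cos (2 * pi * of_int k * t)) -
      (h (cos (2 * pi * t)) * cos (2 * pi * of_int k * t)))"
    unfolding moment_def by (intro integral_diff[symmetric] integrable_continuous_interval cont g h)
  also have "norm \<dots> \<le> integral {0..1} (\<lambda>t::real. e)"
  proof (rule integral_norm_bound_integral)
    fix t :: real
    have "\<bar>g (cos (2 * pi * t)) - h (cos (2 * pi * t))\<bar> * \<bar>cos (2 * pi * of_int k * t)\<bar> \<le> e * 1"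
      using le[of "cos (2 * pi * t)"] by (intro mult_mono) auto
    then show "norm ((g (cos (2 * pi * t)) * cos (2 * pi * of_int k * t)) -
        (h (cos (2 * pi * t)) * cos (2 * pi * of_int k * t))) \<le> e"
      by (simp add: abs_mult flip: left_diff_distrib)
  qed (intro integrable_continuous_interval continuous_intros cont g h)+
  finally show ?thesis by simp
qed

text \<open>Integrate the derivative of \<open>E t * sin (2 * pi * of_int k * t)\<close> over a
  period: the boundary values are 0, and the product of sines is a difference of cosines.\<close>

lemma moment_exp_recurrence:
  "of_int k * moment (\<lambda>u. exp (2 * \<eta> * u)) k =
     \<eta> * (moment (\<lambda>u. exp (2 * \<eta> * u)) (k - 1) - moment (\<lambda>u. exp (2 * \<eta> * u)) (k + 1))"
proof -
  define E where "E t = exp (2 * \<eta> * cos (2 * pi * t))" for t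
  define f where "f j t = E t * cos (2 * pi * of_int j * t)" for j :: int and t
  have f: "(f j has_integral moment (\<lambda>u. exp (2 * \<eta> * u)) j) {0..1}" for j
    unfolding moment_def f_def E_def
    by (intro integrable_integral integrable_continuous_interval continuous_intros)
  have "((\<lambda>t. E t * sin (2 * pi * of_int k * t)) has_real_derivative
      2 * pi * (of_int k * f k t - \<eta> * (f (k - 1) t - f (k + 1) t))) (at t within {0..1})" for t
  proof -
    have *: "f (k - 1) t - f (k + 1) t = 2 * E t * sin (2 * pi * t) * sin (2 * pi * of_int k * t)"
    proof -
      have "2 * pi * of_int (k - 1) * t = 2 * pi * of_int k * t - 2 * pi * t"
        "2 * pi * of_int (k + 1) * t = 2 * pi * of_int k * t + 2 * pi * t"
        by (simp_all add: algebra_simps)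
      then show ?thesis
        by (simp only: f_def cos_diff cos_add) (simp add: algebra_simps)
    qed
    show ?thesis
      unfolding * unfolding f_def E_def
      by (auto intro!: derivative_eq_intros simp: algebra_simps)
  qed
  then have "((\<lambda>t. 2 * pi * (of_int k * f k t - \<eta> * (f (k - 1) t - f (k + 1) t))) has_integral
      E 1 * sin (2 * pi * of_int k * 1) - E 0 * sin (2 * pi * of_int k * 0)) {0..1}"
    by (intro fundamental_theorem_of_calculus)
       (auto simp: has_real_derivative_iff_has_vector_derivative)
  then have 0: "((\<lambda>t. 2 * pi * (of_int k * f k t - \<eta> * (f (k - 1) t - f (k + 1) t))) has_integral 0) {0..1}"
    by simp
  have "((\<lambda>t. 2 * pi * (of_int k * f k t - \<eta> * (f (k - 1) t - f (k + 1) t))) has_integral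
      2 * pi * (of_int k * moment (\<lambda>u. exp (2 * \<eta> * u)) k -
      \<eta> * (moment (\<lambda>u. exp (2 * \<eta> * u)) (k - 1) - moment (\<lambda>u. exp (2 * \<eta> * u)) (k + 1)))) {0..1}"
    by (intro has_integral_mult_right has_integral_diff f)
  from has_integral_unique[OF 0 this] show ?thesis
    by simp
qed

lemma eventually_at_left_1_small:
  fixes \<eta> :: real
  assumes "\<eta> > 0"
  shows "\<forall>\<^sub>F q in at_left 1. 0 < q \<and> q < 1 \<and> (1 - q) * \<eta> < 1"
proof -
  \<comment> \<open>Nodes below 1 require \<open>(1 - q) * \<eta> < 1\<close>, that is,
    \<open>q > 1 - 1 / \<eta>\<close>.\<close>
  have "\<forall>\<^sub>F q in at_left 1. q \<in> {max 0 (1 - 1 / \<eta>)<..<1}"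
    using assms by (intro eventually_at_left_real) auto
  then show ?thesis
    by eventually_elim (use assms in \<open>auto simp: field_simps\<close>)
qed

lemma tendsto_check_moment:
  assumes "\<eta> > 0"
  shows "((\<lambda>q. moment (check_density ((1 - q) * \<eta>) q) k) \<longlongrightarrow> moment (\<lambda>u. exp (2 * \<eta> * u)) k) (at_left 1)"
proof -
  define e where "e q = exp (2 * \<eta>) * (5 * ((1 - q) * \<eta>) * \<eta>) + exp (2 * \<eta>) * (2 * \<eta> * (1 - sqrt q))" for q
  have "isCont e 1"
    unfolding e_def by (intro continuous_intros)
  then have "(e \<longlongrightarrow> e 1) (at_left 1)"
    by (simp add: continuous_within filterlim_at_split isCont_def)
  then have e: "(e \<longlongrightarrow> 0) (at_left 1)"
    by (simp add: e_def)
  have "\<forall>\<^sub>F q in at_left 1. norm (moment (check_density ((1 - q) * \<eta>) q) k -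
      moment (\<lambda>u. exp (2 * \<eta> * u)) k) \<le> e q"
    using eventually_at_left_1_small[OF assms]
  proof eventually_elim
    case (elim q)
    then have q: "0 < q" "q < 1" "(1 - q) * \<eta> < 1"
      by simp_all
    interpret check: circle_weight "check_density ((1 - q) * \<eta>) q" "check_weight ((1 - q) * \<eta>) q"
      by (rule circle_weight_check[OF assms q])
    show ?case
      unfolding e_def real_norm_def
      by (intro moment_diff_le check.g_continuous check_density_exp[OF assms q]) (auto intro!: continuous_intros)
  qed
  from Lim_null_comparison[OF this e] show ?thesis
    by (rule LIM_zero_cancel)
qed

section \<open>The discrete Painleve equation\<close>

theorem corollary4p12:
  fixes \<eta> :: real
  assumes "\<eta> > 0"
  shows "\<exists>y :: nat \<Rightarrow> complex.
    (\<forall>n. ((\<lambda>q. poly (monic_opuc (check_weight ((1 - q) * \<eta>) q) n) 0) \<longlongrightarrow> y n) (at_left 1)) \<and>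
    (\<forall>n\<ge>1. (y (n - 1) + y (n + 1)) * (1 - (y n)\<^sup>2) + of_real (real n / \<eta>) * y n = 0)"
proof -
  define c where "c = moment (\<lambda>u. exp (2 * \<eta> * u))"
  interpret limit: circle_weight "\<lambda>u. exp (2 * \<eta> * u)" "\<lambda>z. of_real (exp (2 * \<eta> * Re z))"
    by (rule circle_weight_exp)
  have "toeplitz c"
    unfolding c_def by (rule limit.toeplitz_axioms)
  have lim: "((\<lambda>q. poly (monic_opuc (check_weight ((1 - q) * \<eta>) q) n) 0) \<longlongrightarrow>
      of_real (verblunsky c n)) (at_left 1)" for n
  proof -
    have "((\<lambda>q. complex_of_real (verblunsky (moment (check_density ((1 - q) * \<eta>) q)) n)) \<longlongrightarrow>
        of_real (verblunsky c n)) (at_left 1)"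
      unfolding verblunsky_def using tendsto_check_moment[OF assms] \<open>toeplitz c\<close>
      by (intro tendsto_of_real tendsto_szego) (simp_all add: c_def)
    \<comment> \<open>The identification with the orthogonal polynomials is available only for
      \<open>q\<close> close to 1, which suffices for the limit.\<close>
    moreover have "\<forall>\<^sub>F q in at_left 1. complex_of_real (verblunsky (moment (check_density ((1 - q) * \<eta>) q)) n) =
        poly (monic_opuc (check_weight ((1 - q) * \<eta>) q) n) 0"
      using eventually_at_left_1_small[OF assms]
    proof eventually_elim
      case (elim q)
      then show ?case
        by (intro circle_weight.poly_monic_opuc_0[symmetric] circle_weight_check assms) auto
    qed
    ultimately show ?thesis
      by (rule Lim_transform_eventually)
  qed
  \<comment> \<open>With \<open>n = Suc m\<close> this is the equation of the limit moments divided
    by \<open>\<eta>\<close>; \<open>n \<ge> 1\<close> keeps \<open>n - 1\<close> from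
    truncating.\<close>
  have real: "(verblunsky c (n - 1) + verblunsky c (n + 1)) * (1 - (verblunsky c n)\<^sup>2) +
      real n / \<eta> * verblunsky c n = 0" if n: "n \<ge> 1" for n
  proof -
    obtain m where "n = Suc m"
      using n by (cases n) auto
    then show ?thesis
      using toeplitz.discrete_painleve[OF \<open>toeplitz c\<close>, of \<eta> m] assms moment_exp_recurrence[of _ \<eta>]
      by (simp add: c_def field_simps)
  qed
  have painleve: "(complex_of_real (verblunsky c (n - 1)) + of_real (verblunsky c (n + 1))) *
      (1 - (of_real (verblunsky c n))\<^sup>2) + of_real (real n / \<eta>) * of_real (verblunsky c n) = 0"
    if "n \<ge> 1" for n
    using arg_cong[OF real[OF that], of complex_of_real]
    by (simp only: of_real_add of_real_mult of_real_power of_real_diff of_real_1 of_real_0)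
  show ?thesis
    by (rule exI[of _ "\<lambda>n. of_real (verblunsky c n)"]) (use lim painleve in blast)
qed

end
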